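(* Let $Y$ be a locally convex Hausdorff (real) topological vector space with zero vector $\theta$, let $K$ be a proper, closed, convex, pointed cone in $Y$ with $\operatorname{int}K\neq\emptyset$, let $e\in\operatorname{int}K$, and let $\xi_e:Y\to\mathbb{R}$ be the nonlinear scalarization function $\xi_e(y)=\inf\{r\in\mathbb{R}: y\in re-K\}$. Let $(X,\mathcal{S}_p)$ be a $TVS$-cone $S$-metric space with $\mathcal{S}_p:X\times X\times X\to Y$. Then the function $\mathcal{S}_p^S:X\times X\times X\to[0,\infty)$ defined by $\mathcal{S}_p^S=\xi_e\circ\mathcal{S}_p$ is an $S$-metric on $X$.
   Context: **Cones in topological vector spaces.** A nonempty subset $K$ of a topological vector space $Y$ is a convex cone if $K+K\subseteq K$ and $\lambda K\subseteq K$ for all $\lambda\ge 0$; it is pointed if $K\cap(-K)=\{\theta\}$, where $\theta$ is the zero vector. Write $x\precsim_K y$ if $y-x\in K$, and $x\ll y$ if $y-x\in\operatorname{int}K$, where $\operatorname{int}K$ is the interior of $K$. **$TVS$-cone $S$-metric.** Let $X$ be a nonempty set. A function $\mathcal{S}_p:X\times X\times X\to Y$ is a $TVS$-cone $S$-metric on $X$ (with respect to $K$) if for all $x,y,z,a\in X$: (1) $\theta\precsim_K\mathcal{S}_p(x,y,z)$; (2) $\mathcal{S}_p(x,y,z)=\theta$ if and only if $x=y=z$; (3) $\mathcal{S}_p(x,y,z)\precsim_K\mathcal{S}_p(x,x,a)+\mathcal{S}_p(y,y,a)+\mathcal{S}_p(z,z,a)$. The pair $(X,\mathcal{S}_p)$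 is then called a $TVS$-cone $S$-metric space. **$S$-metric.** A function $\mathcal{S}:X\times X\times X\to[0,\infty)$ is an $S$-metric on $X$ if for all $x,y,z,a\in X$: (1) $\mathcal{S}(x,y,z)\ge 0$; (2) $\mathcal{S}(x,y,z)=0$ if and only if $x=y=z$; (3) $\mathcal{S}(x,y,z)\le\mathcal{S}(x,x,a)+\mathcal{S}(y,y,a)+\mathcal{S}(z,z,a)$. *)

theory Defs
  imports "HOL-Analysis.Analysis"
begin

class topological_real_vector = topological_ab_group_add + real_vector +
  assumes tendsto_scaleR_Pair:
    "LIM x (nhds a \<times>\<^sub>F nhds b). fst x *\<^sub>R snd x :> nhds (a *\<^sub>R b)"

text \<open>
  The middle conjunct is \<open>convex V\<close> unfolded; the constant itself, declared for the sort
  \<open>real_vector\<close>, is not admissible in a class specification.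
\<close>

class locally_convex_space = topological_real_vector +
  assumes convex_neighbourhood:
    "open U \<Longrightarrow> 0 \<in> U \<Longrightarrow> 
      \<exists>V. open V \<and>
        (\<forall>x\<in>V. \<forall>y\<in>V. \<forall>u\<ge>0. \<forall>v\<ge>0. u + v = 1 \<longrightarrow> u *\<^sub>R x + v *\<^sub>R y \<in> V) \<and>
        0 \<in> V \<and> V \<subseteq> U"

instance real_normed_vector \<subseteq> locally_convex_space
proof
  fix a :: real and b :: 'a
  show "LIM x (nhds a \<times>\<^sub>F nhds b). fst x *\<^sub>R snd x :> nhds (a *\<^sub>R b)"
    unfolding nhds_prod[symmetric]
    by (intro tendsto_scaleR tendsto_fst tendsto_snd filterlim_ident
        tendsto_fst[where a = "(a, b)", simplified] tendsto_snd[where a = "(a, b)", simplified])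
next
  fix U :: "'a set"
  assume "open U" "0 \<in> U"
  then obtain r where "r > 0" "ball 0 r \<subseteq> U"
    using open_contains_ball by blast
  then have "\<exists>V. open V \<and> convex V \<and> 0 \<in> V \<and> V \<subseteq> U"
    by (intro exI[of _ "ball 0 r"]) auto
  then show "\<exists>V. open V \<and>
      (\<forall>x\<in>V. \<forall>y\<in>V. \<forall>u\<ge>0. \<forall>v\<ge>0. u + v = 1 \<longrightarrow> u *\<^sub>R x + v *\<^sub>R y \<in> V) \<and>
      0 \<in> V \<and> V \<subseteq> U"
    unfolding convex_def .
qed

definition pointed :: "'a::real_vector set \<Rightarrow> bool" where
  "pointed K \<longleftrightarrow> K \<inter> uminus ` K = {0}"

definition cone_le :: "'a::real_vector set \<Rightarrow> 'a \<Rightarrow> 'a \<Rightarrow> bool" where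
  "cone_le K x y \<longleftrightarrow> y - x \<in> K"

definition TVS_cone_S_metric ::
    "'y::topological_real_vector set \<Rightarrow> 'x set \<Rightarrow> ('x \<Rightarrow> 'x \<Rightarrow> 'x \<Rightarrow> 'y) \<Rightarrow> bool" where
  "TVS_cone_S_metric K X S \<longleftrightarrow> X \<noteq> {} \<and>
    (\<forall>x\<in>X. \<forall>y\<in>X. \<forall>z\<in>X. \<forall>a\<in>X.
      cone_le K 0 (S x y z) \<and>
      (S x y z = 0 \<longleftrightarrow> x = y \<and> y = z) \<and>
      cone_le K (S x y z) (S x x a + S y y a + S z z a))"

text \<open>The codomain \<open>[0, \<infinity>)\<close> of an \<open>S\<close>-metric is expressed by the nonnegativity axiom.\<close>

definition S_metric :: "'x set \<Rightarrow> ('x \<Rightarrow> 'x \<Rightarrow> 'x \<Rightarrow> real) \<Rightarrow> bool" where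
  "S_metric X S \<longleftrightarrow> X \<noteq> {} \<and>
    (\<forall>x\<in>X. \<forall>y\<in>X. \<forall>z\<in>X. \<forall>a\<in>X.
      0 \<le> S x y z \<and>
      (S x y z = 0 \<longleftrightarrow> x = y \<and> y = z) \<and>
      S x y z \<le> S x x a + S y y a + S z z a)"

text \<open>
  The infimum below is the genuine one whenever \<open>K\<close> is a closed convex cone with \<open>K \<noteq> UNIV\<close> and
  \<open>e \<in> interior K\<close>: the set is then nonempty and bounded below. Outside this situation
  \<open>Inf\<close> on the reals may be an unspecified value.
\<close>

definition scalarization :: "'a::real_vector set \<Rightarrow> 'a \<Rightarrow> 'a \<Rightarrow> real" where
  "scalarization K e y = Inf {r. y \<in> (\<lambda>k. r *\<^sub>R e - k) ` K}"

end

theory Submission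
  imports Defs
begin

text \<open>
  Since \<open>K\<close> is closed, the infimum defining \<open>\<xi>\<^sub>e(y)\<close> is attained for \<open>y \<in> K\<close>, that is
  \<open>\<xi>\<^sub>e(y) e - y \<in> K\<close>; it is nonnegative because \<open>-e \<notin> K\<close>. Adding such memberships gives monotonicity
  and subadditivity on \<open>K\<close>, and pointedness gives \<open>\<xi>\<^sub>e(y) = 0 \<Longrightarrow> y = 0\<close>.
\<close>

lemma continuous_on_scaleR_left_tvs:
  fixes y :: "'y::topological_real_vector"
  shows "continuous_on A (\<lambda>t. t *\<^sub>R y)"
  unfolding continuous_on_def
proof
  fix a
  have "filterlim (\<lambda>t. (t, y)) (nhds a \<times>\<^sub>F nhds y) (at a within A)"
    by (intro filterlim_Pair tendsto_const tendsto_ident_at)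
  from filterlim_compose[OF tendsto_scaleR_Pair this]
  show "((\<lambda>t. t *\<^sub>R y) \<longlongrightarrow> a *\<^sub>R y) (at a within A)" by simp
qed

text \<open>The line through \<open>e\<close> in direction \<open>y\<close> depends continuously on
  its parameter, so it stays in the open set \<open>interior K\<close> for all small parameters. No
  cone property enters.\<close>

lemma interior_absorbing:
  fixes K :: "'y::topological_real_vector set"
  assumes "e \<in> interior K"
  obtains t where "t > 0" "e + t *\<^sub>R y \<in> K"
proof -
  have "continuous_on UNIV (\<lambda>t. e + t *\<^sub>R y)"
    by (intro continuous_intros continuous_on_scaleR_left_tvs)
  then have "open ((\<lambda>t. e + t *\<^sub>R y) -` interior K)"
    by (intro open_vimage open_interior)
  moreover have "0 \<in> (\<lambda>t. e + t *\<^sub>R y) -` interior K" using assms by simp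
  ultimately obtain d where d: "d > 0" "ball 0 d \<subseteq> (\<lambda>t. e + t *\<^sub>R y) -` interior K"
    by (meson open_contains_ball)
  \<comment> \<open>Half the radius is a strictly positive parameter inside the open ball.\<close>
  then have "d / 2 \<in> (\<lambda>t. e + t *\<^sub>R y) -` interior K" by (auto simp: subset_iff)
  then have "e + (d / 2) *\<^sub>R y \<in> K" using interior_subset by auto
  with d show thesis by (intro that[of "d / 2"]) auto
qed

text \<open>If \<open>- e\<close> were in \<open>K\<close>, adding it to
  \<open>e + t *\<^sub>R y\<close> would cancel \<open>e\<close> and, after rescaling, put every
  \<open>y\<close> into \<open>K\<close>.\<close>

lemma uminus_interior_notin_cone:
  fixes K :: "'y::topological_real_vector set"
  assumes "convex_cone K" "K \<noteq> UNIV" "e \<in> interior K"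
  shows "- e \<notin> K"
proof
  assume e: "- e \<in> K"
  have "y \<in> K" for y
  proof -
    obtain t where t: "t > 0" "e + t *\<^sub>R y \<in> K" using interior_absorbing assms(3) .
    have "(e + t *\<^sub>R y) + - e \<in> K" using convex_cone_add[OF assms(1) t(2) e] .
    then have "t *\<^sub>R y \<in> K" by simp
    from convex_cone_scaleR[OF assms(1) _ this, of "1 / t"] t(1) show ?thesis by simp
  qed
  with assms(2) show False by auto
qed

lemma scalarization_eq: "scalarization K e y = Inf {r. r *\<^sub>R e - y \<in> K}"
proof -
  have "y \<in> (\<lambda>k. r *\<^sub>R e - k) ` K \<longleftrightarrow> r *\<^sub>R e - y \<in> K" for r
    by (auto intro: image_eqI[where x = "r *\<^sub>R e - y"])
  then show ?thesis by (simp add: scalarization_def)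
qed

context
  fixes K :: "'y::topological_real_vector set" and e :: 'y
  assumes cone: "convex_cone K" and closed: "closed K" and proper: "K \<noteq> UNIV"
    and e: "e \<in> interior K"
begin

text \<open>Adding the two members leaves \<open>r *\<^sub>R e\<close>, which for negative
  \<open>r\<close> rescales to \<open>- e\<close>. This supplies the lower bound 0 for the infimum
  when \<open>y\<close> lies in \<open>K\<close>.\<close>

lemma cone_multiple_bound_nonneg:
  assumes "y \<in> K" "r *\<^sub>R e - y \<in> K"
  shows "r \<ge> 0"
proof (rule ccontr)
  assume r: "\<not> r \<ge> 0"
  have "r *\<^sub>R e \<in> K" using convex_cone_add[OF cone assms(2,1)] by simp
  from convex_cone_scaleR[OF cone _ this, of "- (1 / r)"] r have "- e \<in> K" by simp
  then show False using uminus_interior_notin_cone[OF cone proper e] by simp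
qed

lemma scalarization_le:
  assumes "y \<in> K" "r *\<^sub>R e - y \<in> K"
  shows "scalarization K e y \<le> r"
  unfolding scalarization_eq using assms cone_multiple_bound_nonneg
  by (intro cInf_lower bdd_belowI[of _ 0]) auto

lemma scalarization_attained:
  assumes "y \<in> K"
  shows "scalarization K e y *\<^sub>R e - y \<in> K"
proof -
  let ?A = "{r. r *\<^sub>R e - y \<in> K}"
  \<comment> \<open>Moving from \<open>e\<close> in direction \<open>- y\<close> and rescaling by
    \<open>1 / t\<close> shows that \<open>1 / t\<close> is admissible, so the infimum is over a
    nonempty set.\<close>
  obtain t where t: "t > 0" "e + t *\<^sub>R (- y) \<in> K" using interior_absorbing e .
  have "(1 / t) *\<^sub>R (e + t *\<^sub>R (- y)) \<in> K"
    using convex_cone_scaleR[OF cone] t by simp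
  then have "1 / t \<in> ?A" using t(1) by (simp add: scaleR_diff_right)
  moreover have "bdd_below ?A"
    using assms cone_multiple_bound_nonneg by (intro bdd_belowI[of _ 0]) auto
  moreover have "closed ((\<lambda>r. r *\<^sub>R e - y) -` K)"
    by (intro closed_vimage closed continuous_intros continuous_on_scaleR_left_tvs)
  then have "closed ?A" by (simp add: vimage_def)
  ultimately have "Inf ?A \<in> ?A" by (intro closed_contains_Inf) auto
  then show ?thesis by (simp add: scalarization_eq)
qed

lemma scalarization_nonneg: "y \<in> K \<Longrightarrow> 0 \<le> scalarization K e y"
  using cone_multiple_bound_nonneg scalarization_attained by blast

text \<open>At value 0 the attained membership reads \<open>- y \<in> K\<close>, so pointedness
  applies; conversely 0 is admissible for \<open>y = 0\<close>.\<close>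

lemma scalarization_eq_0_iff:
  assumes "pointed K" "y \<in> K"
  shows "scalarization K e y = 0 \<longleftrightarrow> y = 0"
proof
  assume "scalarization K e y = 0"
  then have "- y \<in> K" using scalarization_attained[OF assms(2)] by simp
  then have "y \<in> K \<inter> uminus ` K" using assms(2) by (auto intro: image_eqI[where x = "- y"])
  then show "y = 0" using assms(1) unfolding pointed_def by blast
next
  assume "y = 0"
  then show "scalarization K e y = 0"
    using scalarization_le[of y 0] scalarization_nonneg[of y] assms(2) by simp
qed

text \<open>The optimal multiple for \<open>y\<close> is admissible for \<open>x\<close>, since
  adding \<open>y - x\<close> to its membership turns the subtracted \<open>y\<close> into
  \<open>x\<close>.\<close>

lemma scalarization_mono:
  assumes "x \<in> K" "y \<in> K" "y - x \<in> K"
  shows "scalarization K e x \<le> scalarization K e y"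
  using convex_cone_add[OF cone scalarization_attained[OF assms(2)] assms(3)]
  by (intro scalarization_le assms(1)) simp

lemma scalarization_add_le:
  assumes "x \<in> K" "y \<in> K"
  shows "scalarization K e (x + y) \<le> scalarization K e x + scalarization K e y"
  using convex_cone_add[OF cone scalarization_attained[OF assms(1)] scalarization_attained[OF assms(2)]]
  by (intro scalarization_le convex_cone_add[OF cone] assms) (simp add: algebra_simps)

end

theorem theorem3p4:
  fixes K :: "'y::{locally_convex_space, t2_space} set"
    and e :: 'y
    and X :: "'x set"
    and S\<^sub>p :: "'x \<Rightarrow> 'x \<Rightarrow> 'x \<Rightarrow> 'y"
  assumes "convex_cone K" and "closed K" and "pointed K" and "K \<noteq> UNIV"
    and "interior K \<noteq> {}"
    and "e \<in> interior K"
    and "TVS_cone_S_metric K X S\<^sub>p"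
  shows "S_metric X (\<lambda>x y z. scalarization K e (S\<^sub>p x y z))"
proof -
  note K = assms(1,2,4,6)
  let ?\<xi> = "scalarization K e"
  have S: "S\<^sub>p x y z \<in> K" "S\<^sub>p x y z = 0 \<longleftrightarrow> x = y \<and> y = z"
    "S\<^sub>p x x a + S\<^sub>p y y a + S\<^sub>p z z a - S\<^sub>p x y z \<in> K"
    if "x \<in> X" "y \<in> X" "z \<in> X" "a \<in> X" for x y z a
    using assms(7) that by (auto simp: TVS_cone_S_metric_def cone_le_def)
  have "?\<xi> (S\<^sub>p x y z) \<le> ?\<xi> (S\<^sub>p x x a) + ?\<xi> (S\<^sub>p y y a) + ?\<xi> (S\<^sub>p z z a)"
    if X: "x \<in> X" "y \<in> X" "z \<in> X" "a \<in> X" for x y z a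
  proof -
    \<comment> \<open>Subadditivity is available only on \<open>K\<close>, so the partial sum must
      be placed there before the three terms are split in two stages.\<close>
    have xy: "S\<^sub>p x x a + S\<^sub>p y y a \<in> K" using S(1) X by (intro convex_cone_add[OF K(1)]) auto
    have z: "S\<^sub>p z z a \<in> K" using S(1) X by blast
    have "?\<xi> (S\<^sub>p x y z) \<le> ?\<xi> (S\<^sub>p x x a + S\<^sub>p y y a + S\<^sub>p z z a)"
      using S X by (intro scalarization_mono[OF K] convex_cone_add[OF K(1)]) auto
    also have "\<dots> \<le> ?\<xi> (S\<^sub>p x x a + S\<^sub>p y y a) + ?\<xi> (S\<^sub>p z z a)"
      by (rule scalarization_add_le[OF K xy z])
    also have "?\<xi> (S\<^sub>p x x a + S\<^sub>p y y a) \<le> ?\<xi> (S\<^sub>p x x a) + ?\<xi> (S\<^sub>p y y a)"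
      using S(1) X by (intro scalarization_add_le[OF K]) auto
    finally show ?thesis by simp
  qed
  moreover have "X \<noteq> {}" using assms(7) by (simp add: TVS_cone_S_metric_def)
  ultimately show ?thesis
    using S scalarization_nonneg[OF K] scalarization_eq_0_iff[OF K assms(3)]
    by (simp add: S_metric_def)
qed

end
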